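(* Let $d$ be a positive integer. For all $P(x)\in\mathcal{R}$, we have $\Psi_d\left(S\,\overline{P(x)}\right)=S\,\overline{\Psi_d(P(x))}$ in $\mathcal{R}_q/\Phi_d(q)$.
   Context: Here $q$ and $x$ are commuting indeterminates, $\mathbb{N}=\{0,1,2,\dots\}$, and $\Phi_d$ is the $d$th cyclotomic polynomial. For $n\in\mathbb{Z}$, $[n]_q:=(q^n-1)/(q-1)\in\mathbb{Z}[q,q^{-1}]$; for $n\in\mathbb{N}$, $[n]_q!:=[n]_q\cdots[1]_q$ with $[0]_q!:=1$. $\mathcal{R}:=\{P(x)\in\mathbb{Q}[x] : P(n)\in\mathbb{Z}\text{ for all }n\in\mathbb{N}\}$ is a free $\mathbb{Z}$-module with basis $\binom{x}{k}:=\frac{x(x-1)\cdots(x-k+1)}{k!}$ ($k\ge1$), $\binom{x}{0}:=1$. $\mathcal{R}_q:=\{P(x)\in\mathbb{Q}(q)[x] : P([n]_q)\in\mathbb{Z}[q,q^{-1}]\text{ for all }n\in\mathbb{Z}\}$ is a free $\mathbb{Z}[q,q^{-1}]$-module with basis $\genfrac{[}{]}{0pt}{}{x}{k}:=\frac{x(x-[1]_q)\cdots(x-[k-1]_q)}{q^{\binom{k}{2}}[k]_q!}$ ($k\ge1$), $\genfrac{[}{]}{0pt}{}{x}{0}:=1$. $\mathcal{R}_q/\Phi_d(q)$ is the quotient of $\mathcal{R}_q$ by the ideal generated by $\Phi_d(q)$. The quantum Frobenius map $\Psi_d\colon\mathcal{R}\to\mathcal{R}_q/\Phi_d(q)$ is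 the $\mathbb{Z}$-linear map (in fact a ring homomorphism) with $\Psi_d\left(\binom{x}{k}\right)=\genfrac{[}{]}{0pt}{}{x}{dk}$. On $\mathcal{R}_q$: the shift operator $S$ is the restriction of the $\mathbb{Q}(q)$-linear ring automorphism of $\mathbb{Q}(q)[x]$ with $S(x)=qx+1$, and the bar involution is the restriction of the ring involution of $\mathbb{Q}(q)[x]$ determined by $\overline{q}=q^{-1}$ and $\overline{x}=-qx$. Both induce maps on $\mathcal{R}_q/\Phi_d(q)$ (as $\Phi_d(q^{-1})$ is a unit of $\mathbb{Z}[q,q^{-1}]$ times $\Phi_d(q)$), denoted the same way. On $\mathcal{R}$ (the specialization $q:=1$): $S$ is $P(x)\mapsto P(x+1)$ and $\overline{\;\cdot\;}$ is $P(x)\mapsto P(-x)$. *)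

theory Defs
  imports
    "HOL-Computational_Algebra.Computational_Algebra"
    "HOL-Algebra.QuotRing"
begin

text \<open>
  The field \<open>\<rat>(q)\<close> is the type \<open>rat poly fract\<close>, and \<open>\<rat>(q)[x]\<close> is the type of polynomials over it.
\<close>

type_synonym ratfun = "rat poly fract"

definition q :: ratfun where
  "q = to_fract [:0, 1:]"

definition qconst :: "rat \<Rightarrow> ratfun" where
  "qconst c = to_fract [:c:]"

definition laurent_int :: "ratfun set" where
  "laurent_int = {to_fract (map_poly rat_of_int p) / q ^ n | p n. True}"

definition qint :: "int \<Rightarrow> ratfun" where
  "qint n = (q powi n - 1) / (q - 1)"

definition qfact :: "nat \<Rightarrow> ratfun" where
  "qfact n = (\<Prod>i=1..n. qint (int i))"

section \<open>Cyclotomic polynomials\<close>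

definition primitive_roots :: "nat \<Rightarrow> complex set" where
  "primitive_roots d = {z. z ^ d = 1 \<and> (\<forall>k. 0 < k \<and> k < d \<longrightarrow> z ^ k \<noteq> 1)}"

definition cyclotomic :: "nat \<Rightarrow> int poly" where
  "cyclotomic d = (THE p. map_poly of_int p = (\<Prod>z\<in>primitive_roots d. [:- z, 1:]))"

lemma cyclotomic_prod:
  assumes "d > 0"
  shows "(\<Prod>e | e dvd d. \<Prod>z\<in>primitive_roots e. [:- z, 1:]) = monom 1 d - 1"
proof -
  let ?f = "monom 1 d - 1 :: complex poly"
  have rt: "poly ?f z = 0 \<longleftrightarrow> z ^ d = 1" for z by (simp add: poly_monom)
  have lc: "lead_coeff ?f = 1"
  proof -
    have "degree ?f = d"
      using assms by (intro antisym degree_le le_degree) (auto simp: coeff_monom)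
    then show ?thesis using assms by simp
  qed
  have "rsquarefree ?f"
    using assms by (auto simp: rsquarefree_roots rt pderiv_monom pderiv_diff poly_monom power_0_left)
  then have f: "(\<Prod>z | z ^ d = 1. [:- z, 1:]) = ?f"
    using complex_poly_decompose_rsquarefree[of ?f] by (simp only: lc rt smult_1_left)
  have un: "(\<Union>e\<in>{e. e dvd d}. primitive_roots e) = {z. z ^ d = 1}"
  proof (intro equalityI subsetI)
    fix z assume "z \<in> {z::complex. z ^ d = 1}"
    then have z: "z ^ d = 1" by simp
    define e where "e = (LEAST k. 0 < k \<and> z ^ k = 1)"
    have e: "0 < e \<and> z ^ e = 1"
      unfolding e_def by (rule LeastI[of _ d]) (use z assms in auto)
    have least: "z ^ k \<noteq> 1" if "0 < k" "k < e" for k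
      using that not_less_Least[of k "\<lambda>k. 0 < k \<and> z ^ k = 1"] by (auto simp: e_def)
    have "z ^ (d mod e) = 1"
    proof -
      have "z ^ d = (z ^ e) ^ (d div e) * z ^ (d mod e)"
        by (metis mult_div_mod_eq power_add power_mult)
      then show ?thesis using z e by simp
    qed
    then have "e dvd d" using least[of "d mod e"] e by (auto simp: dvd_eq_mod_eq_0)
    then show "z \<in> (\<Union>e\<in>{e. e dvd d}. primitive_roots e)"
      using e least by (auto simp: primitive_roots_def)
  qed (auto simp: primitive_roots_def power_mult elim!: dvdE)
  have fin: "finite {z::complex. z ^ d = 1}" using assms by (simp add: finite_roots_unity)
  have "(\<Prod>z\<in>(\<Union>e\<in>{e. e dvd d}. primitive_roots e). [:- z, 1:]) =
      (\<Prod>e | e dvd d. \<Prod>z\<in>primitive_roots e. [:- z, 1:])"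
  proof (rule prod.UNION_disjoint)
    show "finite {e. e dvd d}" using assms by simp
    show "\<forall>e\<in>{e. e dvd d}. finite (primitive_roots e)"
      using un fin by (metis finite_subset UN_upper)
    show "\<forall>i\<in>{e. e dvd d}. \<forall>j\<in>{e. e dvd d}. i \<noteq> j \<longrightarrow> primitive_roots i \<inter> primitive_roots j = {}"
    proof (intro ballI impI)
      fix i j :: nat assume "i \<in> {e. e dvd d}" "j \<in> {e. e dvd d}" "i \<noteq> j"
      then show "primitive_roots i \<inter> primitive_roots j = {}"
        using assms by (cases i j rule: linorder_cases)
          (auto simp: primitive_roots_def dest: dvd_pos_nat[OF assms])
    qed
  qed
  then show ?thesis using un f by simp
qed

lemma map_of_int_mult:
  "map_poly complex_of_int (p * r) = map_poly of_int p * map_poly of_int r"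
  by (rule poly_eqI) (simp add: coeff_map_poly coeff_mult)

lemma map_of_int_prod:
  "map_poly complex_of_int (prod f A) = (\<Prod>x\<in>A. map_poly of_int (f x))"
  by (induction A rule: infinite_finite_induct) (simp_all add: map_of_int_mult)

lemma cyclotomic_exists:
  "d > 0 \<Longrightarrow> \<exists>p. map_poly of_int p = (\<Prod>z\<in>primitive_roots d. [:- z, 1:])"
proof (induction d rule: less_induct)
  case (less d)
  define C where "C e = (\<Prod>z\<in>primitive_roots e. [:- z, 1:])" for e
  define D where "D = {e. e dvd d} - {d}"
  have fin: "finite {e. e dvd d}" using less.prems by simp
  have "\<forall>e\<in>D. \<exists>p. map_poly of_int p = C e"
  proof
    fix e assume "e \<in> D"
    then have "e < d" "0 < e" using less.prems dvd_imp_le dvd_pos_nat unfolding D_def by fastforce+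
    then show "\<exists>p. map_poly of_int p = C e" unfolding C_def by (rule less.IH)
  qed
  then obtain c where c: "\<And>e. e \<in> D \<Longrightarrow> map_poly of_int (c e) = C e" by metis
  define g where "g = prod c D"
  have g: "map_poly of_int g = prod C D" by (simp add: g_def map_of_int_prod c)
  have inj: "map_poly complex_of_int p = map_poly of_int r \<longleftrightarrow> p = r" for p r
    by (auto simp: poly_eq_iff coeff_map_poly)
  have degm: "degree (map_poly complex_of_int p) = degree p" for p by (rule degree_map_poly) simp
  have "lead_coeff (C e) = 1" for e by (simp add: C_def lead_coeff_prod)
  then have "lead_coeff (prod C D) = 1" by (simp add: lead_coeff_prod)
  then have lg: "lead_coeff g = 1"
    by (metis g degm coeff_map_poly of_int_0 of_int_eq_1_iff)
  then have g0: "g \<noteq> 0" by auto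
  let ?f = "monom 1 d - 1 :: int poly"
  have f: "map_poly of_int ?f = C d * map_poly of_int g"
  proof -
    have "map_poly of_int ?f = (monom 1 d - 1 :: complex poly)"
      by (rule poly_eqI) (simp add: coeff_map_poly coeff_monom)
    also have "\<dots> = (\<Prod>e | e dvd d. C e)"
      using cyclotomic_prod[OF less.prems] by (simp add: C_def)
    also have "\<dots> = C d * prod C D" unfolding D_def using fin by (subst prod.remove[of _ d]) auto
    finally show ?thesis by (simp add: g)
  qed
  obtain s r where sr: "pseudo_divmod ?f g = (s, r)" by fastforce
  have 1: "?f = g * s + r" and 2: "r = 0 \<or> degree r < degree g"
    using pseudo_divmod[OF g0 sr] lg by simp_all
  have "map_poly complex_of_int ?f = map_poly of_int g * map_poly of_int s + map_poly of_int r"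
    by (subst 1, subst map_of_int_mult[symmetric]) (rule poly_eqI, simp add: coeff_map_poly)
  then have r: "map_poly of_int r = map_poly of_int g * (C d - map_poly of_int s)"
    using f by (simp add: algebra_simps)
  have "C d - map_poly of_int s = 0"
  proof (rule ccontr)
    assume nz: "C d - map_poly of_int s \<noteq> 0"
    have gc: "map_poly complex_of_int g \<noteq> 0" using inj[of g 0] g0 by simp
    have "degree r = degree g + degree (C d - map_poly of_int s)"
      using arg_cong[OF r, of degree] degree_mult_eq[OF gc nz] by (simp add: degm)
    moreover have "r \<noteq> 0" using r nz gc by auto
    ultimately show False using 2 by simp
  qed
  then show ?case unfolding C_def by (metis eq_iff_diff_eq_0)
qed

lemma of_int_cyclotomic:
  assumes "d > 0"
  shows "map_poly of_int (cyclotomic d) = (\<Prod>z\<in>primitive_roots d. [:- z, 1:])"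
proof -
  have "\<exists>!p. map_poly of_int p = (\<Prod>z\<in>primitive_roots d. [:- z, 1:])"
    using cyclotomic_exists[OF assms] by (metis (no_types, lifting) poly_eqI coeff_map_poly of_int_0 of_int_eq_iff)
  then show ?thesis unfolding cyclotomic_def by (rule theI')
qed

section \<open>The rings \<open>\<R>\<close> and \<open>\<R>\<^sub>q\<close>\<close>

definition Rint :: "rat poly set" where
  "Rint = {P. \<forall>n::nat. poly P (of_nat n) \<in> \<int>}"

definition binom_poly :: "nat \<Rightarrow> rat poly" where
  "binom_poly k = smult (1 / fact k) (\<Prod>i<k. [:- of_nat i, 1:])"

definition Rq :: "ratfun poly set" where
  "Rq = {P. \<forall>n::int. poly P (qint n) \<in> laurent_int}"

definition qbinom_poly :: "nat \<Rightarrow> ratfun poly" where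
  "qbinom_poly k =
     smult (1 / (q ^ (k choose 2) * qfact k)) (\<Prod>i<k. [:- qint (int i), 1:])"

definition Rq_ring :: "ratfun poly ring" where
  "Rq_ring = \<lparr>carrier = Rq, mult = (*), one = 1, zero = 0, add = (+)\<rparr>"

definition Phi_ideal :: "nat \<Rightarrow> ratfun poly set" where
  "Phi_ideal d = Idl\<^bsub>Rq_ring\<^esub> {[:to_fract (map_poly rat_of_int (cyclotomic d)):]}"

text \<open>
  Elements of \<open>\<R>\<^sub>q/\<Phi>\<^sub>d(q)\<close> are additive cosets of \<open>Phi_ideal d\<close>, i.e. elements of the carrier of
  \<open>Rq_ring Quot Phi_ideal d\<close>.
\<close>

definition Rq_class :: "nat \<Rightarrow> ratfun poly \<Rightarrow> ratfun poly set" where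
  "Rq_class d P = Phi_ideal d +>\<^bsub>Rq_ring\<^esub> P"

section \<open>Shift and bar\<close>

definition shift :: "rat poly \<Rightarrow> rat poly" where
  "shift P = P \<circ>\<^sub>p [:1, 1:]"

definition bar :: "rat poly \<Rightarrow> rat poly" where
  "bar P = P \<circ>\<^sub>p [:0, -1:]"

definition q_shift :: "ratfun poly \<Rightarrow> ratfun poly" where
  "q_shift P = P \<circ>\<^sub>p [:1, q:]"

definition inv_eval :: "rat poly \<Rightarrow> ratfun" where
  "inv_eval p = poly (map_poly qconst p) (inverse q)"

text \<open>
  The automorphism of \<open>\<rat>(q)\<close> with \<open>q \<mapsto> q\<inverse>\<close>: substitute \<open>q\<inverse>\<close> in numerator and denominator; the
  choice of fraction is irrelevant by \<open>bar_coeff_Fract\<close> below.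
\<close>

definition bar_coeff :: "ratfun \<Rightarrow> ratfun" where
  "bar_coeff r = (THE s. \<exists>a b. b \<noteq> 0 \<and> r = Fract a b \<and> s = inv_eval a / inv_eval b)"

lemma map_poly_mult_hom:
  fixes f :: "'a::comm_ring_1 \<Rightarrow> 'b::comm_ring_1"
  assumes "f 0 = 0" "\<And>x y. f (x + y) = f x + f y" "\<And>x y. f (x * y) = f x * f y"
  shows "map_poly f (p * r) = map_poly f p * map_poly f r"
proof (rule poly_eqI)
  have sum_f: "f (sum g A) = (\<Sum>x\<in>A. f (g x))" for g :: "nat \<Rightarrow> 'a" and A
    by (induction A rule: infinite_finite_induct) (simp_all add: assms)
  show "coeff (map_poly f (p * r)) n = coeff (map_poly f p * map_poly f r) n" for n
    by (simp add: coeff_map_poly coeff_mult assms sum_f)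
qed

lemma qconst_simps [simp]:
  "qconst 0 = 0" "qconst (a + b) = qconst a + qconst b" "qconst (a * b) = qconst a * qconst b"
  by (simp_all add: qconst_def flip: to_fract_add to_fract_mult)

lemma poly_qconst_q: "poly (map_poly qconst p) q = to_fract p"
proof (induction p)
  case (pCons a p)
  have "pCons a p = [:a:] + [:0, 1:] * p" by simp
  then have "to_fract (pCons a p) = qconst a + q * to_fract p"
    unfolding qconst_def q_def by (metis to_fract_add to_fract_mult)
  then show ?case using pCons by (simp add: map_poly_pCons)
qed simp

lemma inv_eval_nonzero:
  assumes "p \<noteq> 0"
  shows "inv_eval p \<noteq> 0"
proof
  assume *: "inv_eval p = 0"
  have q0: "q \<noteq> 0" by (simp add: q_def)
  have qc: "qconst a = 0 \<longleftrightarrow> a = 0" for a by (simp add: qconst_def)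
  have deg: "degree (map_poly qconst p) = degree p" by (rule degree_map_poly) (simp add: qc)
  have "map_poly qconst (reflect_poly p) = reflect_poly (map_poly qconst p)"
    by (rule poly_eqI) (simp add: coeff_map_poly coeff_reflect_poly deg)
  then have "to_fract (reflect_poly p) = 0"
    using * q0 by (metis poly_qconst_q poly_reflect_poly_nz inv_eval_def mult_zero_right)
  then show False using assms by simp
qed

lemma bar_coeff_Fract:
  assumes "b \<noteq> 0"
  shows "bar_coeff (Fract a b) = inv_eval a / inv_eval b"
proof -
  have mult: "inv_eval (x * y) = inv_eval x * inv_eval y" for x y
    by (simp add: inv_eval_def map_poly_mult_hom)
  show ?thesis unfolding bar_coeff_def
  proof (rule the_equality)
    show "\<exists>a' b'. b' \<noteq> 0 \<and> Fract a b = Fract a' b' \<and> inv_eval a / inv_eval b = inv_eval a' / inv_eval b'"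
      using assms by blast
  next
    fix s assume "\<exists>a' b'. b' \<noteq> 0 \<and> Fract a b = Fract a' b' \<and> s = inv_eval a' / inv_eval b'"
    then obtain a' b' where *: "b' \<noteq> 0" "Fract a b = Fract a' b'" "s = inv_eval a' / inv_eval b'"
      by blast
    then have "a * b' = a' * b" using assms by (simp add: eq_fract)
    then have "inv_eval a * inv_eval b' = inv_eval a' * inv_eval b" by (metis mult)
    then show "s = inv_eval a / inv_eval b"
      using * assms inv_eval_nonzero by (simp add: frac_eq_eq)
  qed
qed

definition q_bar :: "ratfun poly \<Rightarrow> ratfun poly" where
  "q_bar P = map_poly bar_coeff P \<circ>\<^sub>p [:0, - q:]"

text \<open>
  The map on \<open>\<R>\<^sub>q/\<Phi>\<^sub>d(q)\<close> induced by a map on \<open>\<R>\<^sub>q\<close>: the common class of the images of all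
  representatives.
\<close>

definition induced :: "nat \<Rightarrow> (ratfun poly \<Rightarrow> ratfun poly) \<Rightarrow> ratfun poly set \<Rightarrow> ratfun poly set" where
  "induced d f A = the_elem ((\<lambda>P. Rq_class d (f P)) ` A)"

section \<open>The quantum Frobenius map\<close>

text \<open>The \<open>\<int>\<close>-coordinates with respect to the basis \<open>binom_poly\<close>, unique by \<open>ex1_binom_coords\<close> below.\<close>

definition is_binom_coords :: "rat poly \<Rightarrow> (nat \<Rightarrow> int) \<Rightarrow> bool" where
  "is_binom_coords P c \<longleftrightarrow> finite {k. c k \<noteq> 0} \<and>
     P = (\<Sum>k | c k \<noteq> 0. smult (of_int (c k)) (binom_poly k))"

definition binom_coords :: "rat poly \<Rightarrow> nat \<Rightarrow> int" where
  "binom_coords P = (THE c. is_binom_coords P c)"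

lemma poly_binom_poly: "poly (binom_poly k) (of_nat n) = of_nat (n choose k)"
  by (simp add: binom_poly_def poly_prod binomial_gbinomial gbinomial_prod_rev
      atLeast0LessThan)

lemma is_binom_coords_poly:
  assumes "is_binom_coords P c"
  shows "poly P (of_nat n) = (\<Sum>k\<le>n. of_int (c k) * of_nat (n choose k))"
proof -
  have "poly P (of_nat n) = (\<Sum>k | c k \<noteq> 0. of_int (c k) * of_nat (n choose k))"
    using assms by (simp add: is_binom_coords_def poly_sum poly_binom_poly)
  also have "\<dots> = (\<Sum>k\<in>{k. c k \<noteq> 0} \<inter> {..n}. of_int (c k) * of_nat (n choose k))"
    using assms by (intro sum.mono_neutral_right) (auto simp: is_binom_coords_def not_le)
  also have "\<dots> = (\<Sum>k\<le>n. of_int (c k) * of_nat (n choose k))"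
    by (intro sum.mono_neutral_left) auto
  finally show ?thesis .
qed

lemma binom_poly_span: "\<exists>a. P = (\<Sum>k\<le>m. smult (a k) (binom_poly k))" if "degree P \<le> m"
  using that
proof (induction m arbitrary: P)
  case 0
  then obtain c where "P = [:c:]" by (auto elim: degree_eq_zeroE)
  then show ?case by (intro exI[of _ "\<lambda>_. c"]) (simp add: binom_poly_def)
next
  case (Suc m)
  let ?p = "\<Prod>i<Suc m. [:- of_nat i, 1:] :: rat poly"
  have deg: "degree ?p = Suc m" by (subst degree_prod_eq_sum_degree) auto
  have lc: "coeff ?p (Suc m) = 1"
    using lead_coeff_prod[of "\<lambda>i. [:- of_nat i, 1:] :: rat poly" "{..<Suc m}"] deg by simp
  let ?c = "coeff P (Suc m) * fact (Suc m)"
  have bp: "smult ?c (binom_poly (Suc m)) = smult (coeff P (Suc m)) ?p"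
    unfolding binom_poly_def smult_smult by simp
  have "degree (P - smult ?c (binom_poly (Suc m))) \<le> m"
  proof (rule degree_le, intro allI impI)
    fix i assume "m < i"
    then consider "i = Suc m" | "i > Suc m" by linarith
    then show "coeff (P - smult ?c (binom_poly (Suc m))) i = 0"
      unfolding bp using Suc.prems lc deg
      by cases (simp_all add: coeff_eq_0 del: prod.lessThan_Suc)
  qed
  from Suc.IH[OF this] obtain a where
    a: "P - smult ?c (binom_poly (Suc m)) = (\<Sum>k\<le>m. smult (a k) (binom_poly k))" by blast
  have "P = (\<Sum>k\<le>Suc m. smult ((a(Suc m := ?c)) k) (binom_poly k))"
    using a by (simp add: algebra_simps)
  then show ?case by blast
qed

lemma ex1_binom_coords:
  assumes "P \<in> Rint"
  shows "\<exists>!c. is_binom_coords P c"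
proof (rule ex_ex1I)
  obtain a where a: "P = (\<Sum>k\<le>degree P. smult (a k) (binom_poly k))"
    using binom_poly_span[of P "degree P"] by blast
  define b where "b k = (if k \<le> degree P then a k else 0)" for k
  have val: "poly P (of_nat n) = (\<Sum>k\<le>n. b k * of_nat (n choose k))" for n
  proof -
    have "poly P (of_nat n) = (\<Sum>k\<le>degree P. a k * of_nat (n choose k))"
      by (subst a) (simp add: poly_sum poly_binom_poly)
    also have "\<dots> = (\<Sum>k\<le>max n (degree P). b k * of_nat (n choose k))"
      by (rule sum.mono_neutral_cong_left) (auto simp: b_def)
    also have "\<dots> = (\<Sum>k\<le>n. b k * of_nat (n choose k))"
      by (intro sum.mono_neutral_right) auto
    finally show ?thesis .
  qed
  have int: "b n \<in> \<int>" for n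
  proof (induction n rule: less_induct)
    case (less n)
    have "poly P (of_nat n) = (\<Sum>k<n. b k * of_nat (n choose k)) + b n"
      by (simp add: val flip: lessThan_Suc_atMost)
    moreover have "poly P (of_nat n) \<in> \<int>" using assms by (simp add: Rint_def)
    moreover have "(\<Sum>k<n. b k * of_nat (n choose k)) \<in> \<int>"
      using less by (intro Ints_sum Ints_mult) auto
    ultimately show "b n \<in> \<int>" by (metis Ints_diff add_diff_cancel_left')
  qed
  then have "\<forall>n. \<exists>z. b n = of_int z" by (auto elim: Ints_cases)
  then obtain c where c: "\<And>n. b n = of_int (c n)" by metis
  have sub: "{k. c k \<noteq> 0} \<subseteq> {..degree P}"
  proof
    fix k assume "k \<in> {k. c k \<noteq> 0}"
    then show "k \<in> {..degree P}" using c[of k] by (auto simp: b_def split: if_splits)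
  qed
  have "P = (\<Sum>k\<le>degree P. smult (of_int (c k)) (binom_poly k))"
    by (subst a, rule sum.cong) (simp_all add: b_def flip: c)
  also have "\<dots> = (\<Sum>k | c k \<noteq> 0. smult (of_int (c k)) (binom_poly k))"
    using sub by (intro sum.mono_neutral_right) auto
  finally show "\<exists>c. is_binom_coords P c"
    using finite_subset[OF sub] unfolding is_binom_coords_def by blast
next
  fix c c' assume c: "is_binom_coords P c" "is_binom_coords P c'"
  have "c n = c' n" for n
  proof (induction n rule: less_induct)
    case (less n)
    have "(\<Sum>k\<le>n. rat_of_int (c k) * of_nat (n choose k)) =
        (\<Sum>k\<le>n. rat_of_int (c' k) * of_nat (n choose k))"
      using is_binom_coords_poly[of P] c by metis
    moreover have "(\<Sum>k<n. rat_of_int (c k) * of_nat (n choose k)) =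
        (\<Sum>k<n. rat_of_int (c' k) * of_nat (n choose k))"
      using less by (intro sum.cong) auto
    ultimately show "c n = c' n" by (simp flip: lessThan_Suc_atMost)
  qed
  then show "c = c'" by blast
qed

text \<open>The \<open>\<int>\<close>-linear extension of \<open>binom_poly k \<mapsto> qbinom_poly (d * k)\<close>.\<close>

definition Psi :: "nat \<Rightarrow> rat poly \<Rightarrow> ratfun poly set" where
  "Psi d P = Rq_class d
     (\<Sum>k | binom_coords P k \<noteq> 0. smult (of_int (binom_coords P k)) (qbinom_poly (d * k)))"

end

theory Submission
  imports Defs
begin

text \<open>
  The composite of shift and bar is a reflection in both settings: it replaces \<open>P(x)\<close> by
  \<open>P(-1 - x)\<close> on \<open>\<R>\<close>, and on \<open>\<R>\<^sub>q\<close> the value of the image of \<open>P\<close> at \<open>[n]\<^sub>q\<close> is the bar conjugate of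
  \<open>P([-n - 1]\<^sub>q)\<close>. Since all maps involved are additive, everything comes down to what the two
  reflections do to a basis element.

  The value of the \<open>k\<close>-th \<open>q\<close>-basis polynomial at \<open>[n]\<^sub>q\<close> is the Gaussian binomial coefficient \<open>n\<close>
  over \<open>k\<close>. The value at \<open>[-n - 1]\<^sub>q\<close> is, up to a sign and a power of \<open>q\<close>, the coefficient
  \<open>n + k\<close> over \<open>k\<close>, and the \<open>q\<close>-Vandermonde identity expands the latter in the coefficients \<open>n\<close>
  over \<open>j\<close>. Comparing values at all \<open>[n]\<^sub>q\<close> gives the polynomial identity \<open>reflect_qbinom\<close>: the
  reflection of the \<open>k\<close>-th \<open>q\<close>-basis polynomial has \<open>j\<close>-th coordinate
  \<open>(-1)\<^sup>k q\<^sup>e\<close> times the Gaussian coefficient \<open>k\<close> over \<open>k - j\<close>, where \<open>e = k (k + 1) / 2 + j\<^sup>2\<close>.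
  Its classical counterpart \<open>reflect_binom\<close> has coordinates \<open>(-1)\<^sup>k\<close> times \<open>k\<close> over \<open>j\<close>.

  It remains to see that, with \<open>d k\<close> in place of \<open>k\<close>, the quantum coordinates reduce to the
  classical ones modulo \<open>\<Phi>\<^sub>d(q)\<close>. They are values at \<open>q\<close> of integer polynomials, and such a
  polynomial is divisible by \<open>\<Phi>\<^sub>d\<close> as soon as it vanishes at every primitive \<open>d\<close>-th root of unity
  (\<open>cyclotomic_dvdI\<close>). At such a root \<open>\<zeta>\<close>, Lucas' congruence \<open>gauss_root_of_unity\<close> says that
  \<open>d k\<close> over \<open>i\<close> vanishes unless \<open>i\<close> is a multiple \<open>d j\<close>, when it equals \<open>k\<close> over \<open>j\<close>; the sign and
  the power of \<open>\<zeta>\<close> combine to \<open>(-1)\<^sup>k\<close> by \<open>sign_root_of_unity\<close>. The same divisibility criterion,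
  applied to the reversed polynomial of \<open>\<Phi>\<^sub>d\<close>, shows that the bar involution preserves the ideal,
  so that it acts on classes.
\<close>

section \<open>Gaussian binomial coefficients\<close>

text \<open>
  Taking the base \<open>z\<close> in an arbitrary commutative ring lets one recursion serve for \<open>q\<close>, for
  \<open>q\<^sup>-\<^sup>1\<close>, for roots of unity, and for the indeterminate of \<open>\<int>[X]\<close>, from which all of these arise by
  substitution.
\<close>

fun gauss :: "'a::comm_ring_1 \<Rightarrow> nat \<Rightarrow> nat \<Rightarrow> 'a" where
  "gauss z n 0 = 1"
| "gauss z 0 (Suc k) = 0"
| "gauss z (Suc n) (Suc k) = gauss z n k + z ^ Suc k * gauss z n (Suc k)"

lemma gauss_eq_0: "n < k \<Longrightarrow> gauss z n k = 0"
  by (induction z n k rule: gauss.induct) simp_all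

lemma gauss_self [simp]: "gauss z n n = 1"
  by (induction n) (simp_all add: gauss_eq_0)

text \<open>
  Over a field with \<open>z\<close> elements, this counts the \<open>k\<close>-dimensional subspaces of an
  \<open>(m + n)\<close>-dimensional space by the dimension \<open>i\<close> of their intersection with a fixed subspace of
  dimension \<open>m\<close>. The proof is by the Pascal recursion in \<open>m\<close>; the summands
  with \<open>i > m\<close>, where the truncated exponent has no meaning, vanish.
\<close>

lemma gauss_vandermonde:
  "gauss z (m + n) k = (\<Sum>i\<le>k. z ^ ((m - i) * (k - i)) * gauss z m i * gauss z n (k - i))"
proof (induction m arbitrary: k)
  case 0
  have "(\<Sum>i\<le>k. z ^ ((0 - i) * (k - i)) * gauss z 0 i * gauss z n (k - i))
      = (\<Sum>i\<in>{0}. z ^ ((0 - i) * (k - i)) * gauss z 0 i * gauss z n (k - i))"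
    by (rule sum.mono_neutral_right) (auto simp: gauss_eq_0)
  then show ?case by simp
next
  case (Suc m)
  show ?case
  proof (cases k)
    case (Suc l)
    \<comment> \<open>The exponents on both sides agree when \<open>i < m\<close>; otherwise the Gaussian coefficient is zero.\<close>
    have e: "z ^ Suc l * (z ^ ((m - Suc i) * (l - i)) * gauss z m (Suc i) * gauss z n (l - i))
        = z ^ ((m - i) * (l - i)) * (z ^ Suc i * gauss z m (Suc i)) * gauss z n (l - i)"
      if "i \<le> l" for i
    proof (cases "Suc i \<le> m")
      case True
      then obtain a where a: "m = Suc i + a" by (auto simp: le_iff_add)
      obtain b where b: "l = i + b" using \<open>i \<le> l\<close> by (auto simp: le_iff_add)
      have "z ^ Suc l * z ^ ((m - Suc i) * (l - i)) = z ^ ((m - i) * (l - i)) * z ^ Suc i"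
        by (simp only: power_add[symmetric]) (simp add: a b algebra_simps)
      then show ?thesis by (simp only: mult.assoc[symmetric])
    qed (simp add: gauss_eq_0)
    have "gauss z (Suc m + n) (Suc l) = gauss z (m + n) l + z ^ Suc l * gauss z (m + n) (Suc l)"
      by simp
    also have "z ^ Suc l * gauss z (m + n) (Suc l) = z ^ (Suc m * Suc l) * gauss z n (Suc l) +
        (\<Sum>i\<le>l. z ^ Suc l * (z ^ ((m - Suc i) * (l - i)) * gauss z m (Suc i) * gauss z n (l - i)))"
      unfolding Suc.IH[of "Suc l"] sum.atMost_Suc_shift
      by (simp add: distrib_left sum_distrib_left power_add mult_ac)
    also have "(\<Sum>i\<le>l. z ^ Suc l * (z ^ ((m - Suc i) * (l - i)) * gauss z m (Suc i) * gauss z n (l - i)))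
      = (\<Sum>i\<le>l. z ^ ((m - i) * (l - i)) * (z ^ Suc i * gauss z m (Suc i)) * gauss z n (l - i))"
      by (intro sum.cong refl e) simp
    also have "gauss z (m + n) l + (z ^ (Suc m * Suc l) * gauss z n (Suc l) + \<dots>)
        = z ^ (Suc m * Suc l) * gauss z n (Suc l) +
        (\<Sum>i\<le>l. z ^ ((m - i) * (l - i)) * gauss z (Suc m) (Suc i) * gauss z n (l - i))"
      by (simp add: Suc.IH[of l] sum.distrib[symmetric] distrib_left distrib_right)
    also have "\<dots> = (\<Sum>i\<le>Suc l. z ^ ((Suc m - i) * (Suc l - i)) * gauss z (Suc m) i * gauss z n (Suc l - i))"
      unfolding sum.atMost_Suc_shift by simp
    finally show ?thesis using Suc by simp
  qed simp
qed

text \<open>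
  The \<open>q\<close>-analogue of \<open>(k + 1) C(n + 1, k + 1) = (n + 1) C(n, k)\<close>, cleared of denominators so that
  it also holds where \<open>z\<close> is a root of unity.
\<close>

lemma gauss_absorb:
  "(z ^ Suc k - 1) * gauss z (Suc n) (Suc k) = (z ^ Suc n - 1) * gauss z n k"
proof (induction n arbitrary: k)
  case 0
  then show ?case by (cases k) simp_all
next
  case (Suc n)
  have lower: "(z ^ Suc n - z ^ k) * gauss z (Suc n) k = z ^ k * (z ^ Suc n - 1) * gauss z n k"
  proof (cases k)
    case (Suc j)
    have "(z ^ Suc n - z ^ k) * gauss z (Suc n) k
        = (z ^ Suc n - 1) * gauss z (Suc n) k - (z ^ Suc j - 1) * gauss z (Suc n) (Suc j)"
      by (simp add: Suc algebra_simps)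
    also have "\<dots> = z ^ k * (z ^ Suc n - 1) * gauss z n k"
      unfolding Suc.IH Suc by (simp add: algebra_simps)
    finally show ?thesis .
  qed simp
  have "(z ^ Suc k - 1) * gauss z (Suc (Suc n)) (Suc k)
      = (z ^ Suc k - 1) * gauss z (Suc n) k
        + z ^ Suc k * ((z ^ Suc k - 1) * gauss z (Suc n) (Suc k))"
    by (simp add: algebra_simps)
  also have "\<dots> = (z ^ Suc k - 1) * gauss z (Suc n) k
        + z * ((z ^ Suc n - z ^ k) * gauss z (Suc n) k)"
    unfolding Suc.IH lower by (simp add: algebra_simps)
  also have "\<dots> = (z ^ Suc (Suc n) - 1) * gauss z (Suc n) k"
    by (simp add: algebra_simps)
  finally show ?case .
qed

text \<open>
  The recursion in the lower index that mirrors the extra factor \<open>x - [k]\<^sub>q\<close> by which consecutive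
  \<open>q\<close>-basis polynomials differ.
\<close>

lemma gauss_step:
  "(z ^ n - z ^ k) * gauss z n k = z ^ k * ((z ^ Suc k - 1) * gauss z n (Suc k))"
proof (cases n)
  case 0
  then show ?thesis by (cases k) simp_all
next
  case (Suc m)
  show ?thesis
  proof (cases k)
    case (Suc j)
    have "(z ^ n - z ^ k) * gauss z n k
        = (z ^ n - 1) * gauss z n k - (z ^ Suc j - 1) * gauss z n (Suc j)"
      by (simp add: Suc algebra_simps)
    also have "\<dots> = z ^ k * ((z ^ Suc m - 1) * gauss z m k)"
      unfolding \<open>n = Suc m\<close> gauss_absorb Suc by (simp add: algebra_simps)
    finally show ?thesis unfolding \<open>n = Suc m\<close> gauss_absorb .
  qed (use gauss_absorb[of z 0 m] in \<open>simp add: \<open>n = Suc m\<close>\<close>)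
qed

lemma gauss_one: "gauss 1 n k = of_nat (n choose k)"
  by (induction "1 :: 'a" n k rule: gauss.induct) simp_all

text \<open>
  The coefficient \<open>n + k\<close> over \<open>k\<close> is a palindromic polynomial of degree \<open>n k\<close> in its base. Here this follows
  from absorption at \<open>z\<close> and at \<open>z\<^sup>-\<^sup>1\<close>, which requires that the factors \<open>z\<^sup>k - 1\<close> can be cancelled.
\<close>

lemma gauss_inverse:
  fixes z :: "'a::field"
  assumes z: "z \<noteq> 0" "\<And>n. n > 0 \<Longrightarrow> z ^ n \<noteq> 1"
  shows "z ^ (n * k) * gauss (inverse z) (n + k) k = gauss z (n + k) k"
proof (induction k)
  case (Suc k)
  let ?y = "inverse z"
  have inv: "z ^ j * (?y ^ j - 1) = - (z ^ j - 1)" for j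
    using z(1) by (simp add: algebra_simps power_inverse)
  have e: "z ^ Suc k - 1 = - (z ^ Suc k * (?y ^ Suc k - 1))"
    using inv[of "Suc k"] by simp
  have "(z ^ Suc k - 1) * (z ^ (n * Suc k) * gauss ?y (n + Suc k) (Suc k))
      = - (z ^ Suc k * z ^ (n * Suc k) * ((?y ^ Suc k - 1) * gauss ?y (Suc (n + k)) (Suc k)))"
    unfolding add_Suc_right by (subst e) (simp add: mult_ac del: power_Suc gauss.simps)
  also have "\<dots> = - (z ^ (n * k) * (z ^ Suc (n + k) * (?y ^ Suc (n + k) - 1)) * gauss ?y (n + k) k)"
    unfolding gauss_absorb by (simp add: power_add mult_ac)
  also have "\<dots> = (z ^ Suc (n + k) - 1) * gauss z (n + k) k"
    unfolding inv Suc.IH[symmetric] by (simp add: algebra_simps)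
  also have "\<dots> = (z ^ Suc k - 1) * gauss z (n + Suc k) (Suc k)"
    by (simp only: gauss_absorb add_Suc_right)
  finally show ?case using z(2)[of "Suc k"] by simp
qed simp

section \<open>Roots of unity\<close>

text \<open>
  Lucas' congruence. Absorption kills every coefficient \<open>d\<close> over \<open>i\<close> with \<open>0 < i < d\<close>, so the
  Vandermonde identity for \<open>d + d k\<close> retains only the terms \<open>i = 0\<close> and \<open>i = d\<close>, and becomes the
  ordinary Pascal recursion in steps of \<open>d\<close>.
\<close>

lemma gauss_root_of_unity:
  fixes z :: "'a::idom"
  assumes d: "d > 0" and z: "z ^ d = 1" "\<And>k. 0 < k \<Longrightarrow> k < d \<Longrightarrow> z ^ k \<noteq> 1"
  shows "gauss z (d * k) j = (if d dvd j then of_nat (k choose (j div d)) else 0)"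
proof (induction k arbitrary: j)
  case 0
  show ?case using d by (cases "j = 0") (auto simp: gauss_eq_0 binomial_eq_0 elim!: dvdE)
next
  case (Suc k)
  have mid: "gauss z d i = 0" if i: "0 < i" "i < d" for i
    using gauss_absorb[of z "i - 1" "d - 1"] z i by simp
  define f where "f i = z ^ ((d - i) * (j - i)) * gauss z d i * gauss z (d * k) (j - i)" for i
  have f0: "f 0 = gauss z (d * k) j"
    using z(1) by (simp add: f_def power_mult)
  have fd: "f d = gauss z (d * k) (j - d)"
    by (simp add: f_def)
  have "gauss z (d * Suc k) j = (\<Sum>i\<le>j. f i)"
    using gauss_vandermonde[of z d "d * k" j] by (simp add: f_def)
  also have "\<dots> = (\<Sum>i\<in>{0, d} \<inter> {..j}. f i)"
  proof (rule sum.mono_neutral_right)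
    show "\<forall>i\<in>{..j} - {0, d} \<inter> {..j}. f i = 0"
    proof
      fix i assume "i \<in> {..j} - {0, d} \<inter> {..j}"
      then have "0 < i" "i < d \<or> d < i" by auto
      then show "f i = 0" using mid gauss_eq_0[of d i z] by (auto simp: f_def)
    qed
  qed auto
  also have "\<dots> = gauss z (d * k) j + (if d \<le> j then gauss z (d * k) (j - d) else 0)"
    using d by (auto simp: f0 fd)
  also have "\<dots> = (if d dvd j then of_nat (Suc k choose (j div d)) else 0)"
  proof (cases "d \<le> j")
    case True
    then have "j div d = Suc ((j - d) div d)" "d dvd j - d \<longleftrightarrow> d dvd j"
      using d by (simp_all add: le_div_geq dvd_minus_self)
    with True show ?thesis by (simp add: Suc.IH)
  next
    case False
    then show ?thesis using d by (cases "j = 0") (auto simp: Suc.IH dest: dvd_imp_le)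
  qed
  finally show ?case .
qed

text \<open>
  The product of \<open>-z\<^sup>i\<close> over a full period \<open>1 \<le> i \<le> d\<close> is \<open>-1\<close>: for odd \<open>d\<close> the powers of \<open>z\<close>
  multiply to \<open>1\<close>, and for even \<open>d\<close> they multiply to \<open>z\<^bsup>d/2\<^esup> = -1\<close>. The left-hand side is this product taken over \<open>k\<close> periods.
\<close>

lemma sign_root_of_unity:
  fixes z :: "'a::idom"
  assumes d: "d > 0" and z: "z ^ d = 1" "\<And>k. 0 < k \<Longrightarrow> k < d \<Longrightarrow> z ^ k \<noteq> 1"
  shows "(-1) ^ (d * k) * z ^ (Suc (d * k) choose 2) = (-1) ^ k"
proof -
  have one: "(-1) ^ d * z ^ (Suc d choose 2) = -1"
  proof (cases "even d")
    case True
    then obtain m where m: "d = 2 * m" by auto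
    have "(z ^ m) ^ 2 = 1" using z(1) by (simp add: m power_mult[symmetric] mult.commute)
    moreover have "z ^ m \<noteq> 1" using z(2)[of m] d m by simp
    ultimately have "z ^ m = -1" by (simp add: power2_eq_1_iff)
    moreover have "Suc d choose 2 = m * Suc (2 * m)" by (simp add: choose_two m)
    ultimately show ?thesis using True by (simp only: power_mult) simp
  next
    case False
    then obtain m where m: "d = 2 * m + 1" by (elim oddE)
    have "Suc d choose 2 = (2 * (d * Suc m)) div 2"
      unfolding choose_two by (rule arg_cong[where f = "\<lambda>t. t div 2"]) (simp add: m algebra_simps)
    then have "Suc d choose 2 = d * Suc m" by simp
    then show ?thesis using z(1) False by (simp only: power_mult) simp
  qed
  have add: "Suc (a + b) choose 2 = (Suc a choose 2) + (Suc b choose 2) + a * b" for a b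
    by (induction b) (simp_all add: numeral_2_eq_2)
  show ?thesis
  proof (induction k)
    case (Suc k)
    have "(-1) ^ (d * Suc k) * z ^ (Suc (d * Suc k) choose 2)
      = ((-1) ^ d * z ^ (Suc d choose 2)) * ((-1) ^ (d * k) * z ^ (Suc (d * k) choose 2)) * z ^ (d * (d * k))"
      unfolding mult_Suc_right add by (simp add: power_add mult_ac)
    then show ?case unfolding one Suc.IH using z(1) by (simp add: power_mult)
  qed (simp add: numeral_2_eq_2)
qed

section \<open>Divisibility by cyclotomic polynomials\<close>

text \<open>
  The ring homomorphism from \<open>\<int>[X]\<close> to any commutative ring that sends \<open>X\<close> to \<open>x\<close>. Evaluating the
  same integer polynomial at \<open>q\<close> and at complex roots of unity carries information from the latter
  to the former.
\<close>

definition ieval :: "'a::comm_ring_1 \<Rightarrow> int poly \<Rightarrow> 'a" where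
  "ieval x p = poly (map_poly of_int p) x"

lemma ieval_mult: "ieval x (p * r) = ieval x p * ieval x r"
  by (simp add: ieval_def map_poly_mult_hom)

lemma ieval_add: "ieval x (p + r) = ieval x p + ieval x r"
proof -
  have "map_poly of_int (p + r) = (map_poly of_int p + map_poly of_int r :: 'a poly)"
    by (rule poly_eqI) (simp add: coeff_map_poly)
  then show ?thesis by (simp add: ieval_def)
qed

lemma ieval_diff: "ieval x (p - r) = ieval x p - ieval x r"
  using ieval_add[of x "p - r" r] by simp

lemma ieval_pCons [simp]: "ieval x (pCons a p) = of_int a + x * ieval x p"
  by (simp add: ieval_def map_poly_pCons)

lemma ieval_0 [simp]: "ieval x 0 = 0"
  by (simp add: ieval_def)

lemma ieval_1 [simp]: "ieval x 1 = 1"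
  by (simp add: ieval_def)

lemma ieval_power: "ieval x (p ^ n) = ieval x p ^ n"
  by (induction n) (simp_all add: ieval_mult)

lemma ieval_gauss: "ieval x (gauss p n k) = gauss (ieval x p) n k"
  by (induction p n k rule: gauss.induct) (simp_all add: ieval_add ieval_mult ieval_power)

lemma ieval_reflect:
  fixes x :: "'a::field_char_0"
  assumes "x \<noteq> 0"
  shows "ieval x (reflect_poly p) = x ^ degree p * ieval (inverse x) p"
proof -
  have deg: "degree (map_poly of_int p :: 'a poly) = degree p" by (rule degree_map_poly) simp
  have "map_poly of_int (reflect_poly p) = (reflect_poly (map_poly of_int p) :: 'a poly)"
    by (rule poly_eqI) (simp add: coeff_map_poly coeff_reflect_poly deg)
  then show ?thesis using assms by (simp add: ieval_def poly_reflect_poly_nz deg)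
qed

lemma finite_primitive_roots: "d > 0 \<Longrightarrow> finite (primitive_roots d)"
  by (rule finite_subset[of _ "{z. z ^ d = 1}"])
    (auto simp: primitive_roots_def finite_roots_unity)

lemma ieval_cyclotomic:
  assumes "d > 0" "z \<in> primitive_roots d"
  shows "ieval z (cyclotomic d) = 0"
  using assms by (auto simp: ieval_def of_int_cyclotomic poly_prod finite_primitive_roots)

text \<open>
  As the divisor is monic, division with remainder stays in \<open>\<int>[X]\<close>, and the remainder has more roots
  than its degree allows.
\<close>

lemma cyclotomic_dvdI:
  assumes d: "d > 0" and p: "\<And>z. z \<in> primitive_roots d \<Longrightarrow> ieval z p = 0"
  shows "cyclotomic d dvd p"
proof -
  let ?C = "map_poly complex_of_int"
  let ?g = "cyclotomic d"
  have deg: "degree (?C r) = degree r" for r by (rule degree_map_poly) simp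
  have "lead_coeff (?C ?g) = 1" by (simp add: of_int_cyclotomic[OF d] lead_coeff_prod)
  then have lg: "lead_coeff ?g = 1" by (simp add: deg coeff_map_poly)
  have dg: "degree ?g = card (primitive_roots d)"
    unfolding deg[of ?g, symmetric] of_int_cyclotomic[OF d]
    by (subst degree_prod_eq_sum_degree) auto
  have g0: "?g \<noteq> 0" using lg by auto
  obtain s r where sr: "pseudo_divmod p ?g = (s, r)" by fastforce
  have 1: "p = ?g * s + r" and 2: "r = 0 \<or> degree r < degree ?g"
    using pseudo_divmod[OF g0 sr] lg by simp_all
  have root: "poly (?C r) z = 0" if "z \<in> primitive_roots d" for z
    using p[OF that] ieval_cyclotomic[OF d that] arg_cong[OF 1, of "ieval z"]
    by (simp add: ieval_add ieval_mult) (simp add: ieval_def)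
  have "r = 0"
  proof (rule ccontr)
    assume "r \<noteq> 0"
    then have "?C r = 0"
      using 2 root by (intro poly_eqI_degree[of "primitive_roots d"]) (auto simp: deg dg)
    then show False using \<open>r \<noteq> 0\<close> by (auto simp: poly_eq_iff coeff_map_poly)
  qed
  then show ?thesis using 1 by simp
qed

text \<open>The primitive roots are permuted by inversion.\<close>

lemma cyclotomic_dvd_reflect:
  assumes "d > 0"
  shows "cyclotomic d dvd reflect_poly (cyclotomic d)"
proof (rule cyclotomic_dvdI[OF assms])
  fix z assume z: "z \<in> primitive_roots d"
  then have "z \<noteq> 0" using assms by (auto simp: primitive_roots_def power_0_left)
  have "inverse z \<in> primitive_roots d"
    using z by (auto simp: primitive_roots_def power_inverse)
  then show "ieval z (reflect_poly (cyclotomic d)) = 0"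
    using \<open>z \<noteq> 0\<close> by (simp add: ieval_reflect ieval_cyclotomic[OF assms])
qed

section \<open>Laurent polynomials\<close>

lemma of_int_ratfun: "(of_int n :: ratfun) = to_fract [:of_int n:]"
proof -
  have nat: "(of_nat m :: ratfun) = to_fract (of_nat m)" for m
    by (induction m) simp_all
  have "(of_int n :: ratfun) = to_fract (of_int n)"
    by (cases n rule: int_diff_cases) (simp add: nat)
  then show ?thesis by (simp add: of_int_poly)
qed

lemma to_fract_of_int_poly: "to_fract (map_poly rat_of_int p) = ieval q p"
proof (induction p)
  case (pCons a p)
  have "map_poly rat_of_int (pCons a p) = [:of_int a:] + [:0, 1:] * map_poly of_int p"
    by (simp add: map_poly_pCons)
  then have "to_fract (map_poly rat_of_int (pCons a p)) = of_int a + q * to_fract (map_poly of_int p)"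
    unfolding q_def of_int_ratfun by (metis to_fract_add to_fract_mult)
  then show ?case using pCons by simp
qed simp

lemma q_nonzero [simp]: "q \<noteq> 0"
  by (simp add: q_def)

text \<open>
  This makes the quotients \<open>(q\<^sup>n - 1) / (q - 1)\<close> invertible for \<open>n > 0\<close> and pairwise distinct for
  \<open>n \<ge> 0\<close>, which is what allows polynomials to be recovered from their values at them.
\<close>

lemma q_power_neq_1: "n > 0 \<Longrightarrow> q ^ n \<noteq> 1"
proof
  assume n: "n > 0" and "q ^ n = 1"
  have "q ^ n = to_fract (monom 1 n)" for n
    by (induction n) (simp_all add: q_def monom_Suc flip: to_fract_mult)
  then have "monom 1 n = (1 :: rat poly)" using \<open>q ^ n = 1\<close> by (metis to_fract_1 to_fract_eq_iff)
  then have "degree (monom 1 n :: rat poly) = 0" by simp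
  then show False using n by (simp add: degree_monom_eq)
qed

lemma q_neq_1 [simp]: "q \<noteq> 1"
  using q_power_neq_1[of 1] by simp

lemma laurent_int_iff: "a \<in> laurent_int \<longleftrightarrow> (\<exists>p n. a = ieval q p / q ^ n)"
  by (auto simp: laurent_int_def to_fract_of_int_poly)

lemma laurent_of_int: "of_int n \<in> laurent_int"
  unfolding laurent_int_iff by (rule exI[of _ "[:n:]"], rule exI[of _ 0]) simp

lemma laurent_q: "q \<in> laurent_int"
  unfolding laurent_int_iff by (rule exI[of _ "[:0, 1:]"], rule exI[of _ 0]) simp

lemma laurent_inverse_q: "inverse q \<in> laurent_int"
  unfolding laurent_int_iff by (rule exI[of _ 1], rule exI[of _ 1]) (simp add: divide_inverse)

lemma laurent_add: "a \<in> laurent_int \<Longrightarrow> b \<in> laurent_int \<Longrightarrow> a + b \<in> laurent_int"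
proof -
  assume "a \<in> laurent_int" "b \<in> laurent_int"
  then obtain p r m n where "a = ieval q p / q ^ m" "b = ieval q r / q ^ n"
    unfolding laurent_int_iff by blast
  then have "a + b = ieval q (p * [:0, 1:] ^ n + r * [:0, 1:] ^ m) / q ^ (m + n)"
    by (simp add: ieval_add ieval_mult ieval_power add_frac_eq power_add)
  then show ?thesis unfolding laurent_int_iff by blast
qed

lemma laurent_mult: "a \<in> laurent_int \<Longrightarrow> b \<in> laurent_int \<Longrightarrow> a * b \<in> laurent_int"
proof -
  assume "a \<in> laurent_int" "b \<in> laurent_int"
  then obtain p r m n where "a = ieval q p / q ^ m" "b = ieval q r / q ^ n"
    unfolding laurent_int_iff by blast
  then have "a * b = ieval q (p * r) / q ^ (m + n)"
    by (simp add: ieval_mult power_add)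
  then show ?thesis unfolding laurent_int_iff by blast
qed

lemma laurent_0: "0 \<in> laurent_int" and laurent_1: "1 \<in> laurent_int"
  using laurent_of_int[of 0] laurent_of_int[of 1] by simp_all

lemma laurent_uminus: "a \<in> laurent_int \<Longrightarrow> - a \<in> laurent_int"
  using laurent_mult[OF laurent_of_int[of "-1"], of a] by simp

lemma laurent_power: "a \<in> laurent_int \<Longrightarrow> a ^ n \<in> laurent_int"
  by (induction n) (simp_all add: laurent_1 laurent_mult)

lemma laurent_ieval: "a \<in> laurent_int \<Longrightarrow> ieval a p \<in> laurent_int"
  by (induction p) (simp_all add: laurent_0 laurent_add laurent_mult laurent_of_int)

lemma laurent_gauss: "a \<in> laurent_int \<Longrightarrow> gauss a n k \<in> laurent_int"
  using laurent_ieval[of a "gauss [:0, 1:] n k"] by (simp add: ieval_gauss)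

section \<open>The bar involution on coefficients\<close>

lemma bar_coeff_hom:
  "bar_coeff (x + y) = bar_coeff x + bar_coeff y"
  "bar_coeff (x * y) = bar_coeff x * bar_coeff y"
proof -
  have mult: "inv_eval (a * b) = inv_eval a * inv_eval b" for a b
    by (simp add: inv_eval_def map_poly_mult_hom)
  have add: "inv_eval (a + b) = inv_eval a + inv_eval b" for a b
  proof -
    have "map_poly qconst (a + b) = map_poly qconst a + map_poly qconst b"
      by (rule poly_eqI) (simp add: coeff_map_poly)
    then show ?thesis by (simp add: inv_eval_def)
  qed
  obtain a b where x: "x = Fract a b" "b \<noteq> 0" by (cases x)
  obtain c d where y: "y = Fract c d" "d \<noteq> 0" by (cases y)
  note nz = inv_eval_nonzero[OF x(2)] inv_eval_nonzero[OF y(2)]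
  show "bar_coeff (x + y) = bar_coeff x + bar_coeff y"
    using x y nz by (simp add: bar_coeff_Fract mult add add_frac_eq)
  show "bar_coeff (x * y) = bar_coeff x * bar_coeff y"
    using x y by (simp add: bar_coeff_Fract mult)
qed

lemma inv_eval_1: "inv_eval 1 = 1"
proof -
  have "qconst 1 = 1" by (simp add: qconst_def flip: one_pCons)
  then show ?thesis using map_poly_pCons[of qconst 1 0] by (simp add: inv_eval_def flip: one_pCons)
qed

lemma bar_coeff_1 [simp]: "bar_coeff 1 = 1"
  using bar_coeff_Fract[of 1 1] by (simp add: inv_eval_1 One_fract_def)

lemma bar_coeff_0 [simp]: "bar_coeff 0 = 0"
  using bar_coeff_hom(1)[of 0 0] by simp

lemma bar_coeff_uminus: "bar_coeff (- x) = - bar_coeff x"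
  using bar_coeff_hom(1)[of "- x" x] by (simp add: eq_neg_iff_add_eq_0)

lemma bar_coeff_diff: "bar_coeff (x - y) = bar_coeff x - bar_coeff y"
  using bar_coeff_hom(1)[of x "- y"] by (simp add: bar_coeff_uminus)

lemma bar_coeff_inverse: "bar_coeff (inverse x) = inverse (bar_coeff x)"
proof (cases "x = 0")
  case False
  then have "bar_coeff x * bar_coeff (inverse x) = 1"
    using bar_coeff_hom(2)[of x "inverse x"] by simp
  then show ?thesis by (metis inverse_unique)
qed simp

lemma bar_coeff_divide: "bar_coeff (x / y) = bar_coeff x / bar_coeff y"
  by (simp add: divide_inverse bar_coeff_hom bar_coeff_inverse)

lemma bar_coeff_power: "bar_coeff (x ^ n) = bar_coeff x ^ n"
  by (induction n) (simp_all add: bar_coeff_hom)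

lemma bar_coeff_q [simp]: "bar_coeff q = inverse q"
proof -
  have "bar_coeff q = inv_eval [:0, 1:] / inv_eval 1"
    unfolding q_def to_fract_def by (rule bar_coeff_Fract) simp
  also have "inv_eval [:0, 1:] = inverse q"
    by (simp add: inv_eval_def map_poly_pCons qconst_def one_pCons[symmetric])
  finally show ?thesis by (simp add: inv_eval_1)
qed

lemma bar_coeff_of_int: "bar_coeff (of_int n) = of_int n"
proof -
  have "bar_coeff (of_nat m) = of_nat m" for m
    by (induction m) (simp_all add: bar_coeff_hom)
  then show ?thesis by (cases n rule: int_diff_cases) (simp add: bar_coeff_diff)
qed

lemma bar_coeff_ieval: "bar_coeff (ieval x p) = ieval (bar_coeff x) p"
  by (induction p) (simp_all add: bar_coeff_hom bar_coeff_of_int)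

lemma bar_coeff_gauss: "bar_coeff (gauss x n k) = gauss (bar_coeff x) n k"
  by (induction x n k rule: gauss.induct) (simp_all add: bar_coeff_hom bar_coeff_power)

lemma bar_coeff_laurent: "a \<in> laurent_int \<Longrightarrow> bar_coeff a \<in> laurent_int"
proof -
  assume "a \<in> laurent_int"
  then obtain p n where "a = ieval q p / q ^ n" unfolding laurent_int_iff by blast
  then have "bar_coeff a = ieval (inverse q) p * q ^ n"
    by (simp only: bar_coeff_divide bar_coeff_ieval bar_coeff_power bar_coeff_q)
      (simp add: divide_inverse power_inverse)
  then show ?thesis
    by (simp add: laurent_mult laurent_ieval laurent_inverse_q laurent_power laurent_q)
qed

text \<open>
  Conjugated coefficients evaluated at a conjugated argument give the conjugated value. To conjugate
  values of \<open>P\<close>, it therefore suffices to recognise the argument as a conjugate, and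
  \<open>bar_coeff_qint_minus\<close> does so for \<open>-q [n]\<^sub>q\<close>.
\<close>

lemma poly_map_bar_coeff: "poly (map_poly bar_coeff P) (bar_coeff y) = bar_coeff (poly P y)"
  by (induction P) (simp_all add: map_poly_pCons bar_coeff_hom)

lemma bar_coeff_qint_minus: "bar_coeff (qint (- n)) = - q * qint n"
proof -
  have powi: "bar_coeff (q powi (- n)) = q powi n"
    by (simp add: power_int_def bar_coeff_power power_inverse bar_coeff_inverse)
  have "q - 1 \<noteq> 0" "1 - q \<noteq> 0" by simp_all
  then have "(a - 1) / (inverse q - 1) = - q * ((a - 1) / (q - 1))" for a
    by (simp add: field_simps)
  then show ?thesis by (simp add: qint_def bar_coeff_divide bar_coeff_diff powi)
qed

lemma qint_plus_1: "1 + q * qint n = qint (n + 1)"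
proof -
  have "q - 1 \<noteq> 0" by simp
  then show ?thesis by (simp add: qint_def power_int_add field_simps)
qed

section \<open>The operators on \<open>\<R>\<^sub>q\<close>\<close>

lemma poly_q_shift: "poly (q_shift P) (qint n) = poly P (qint (n + 1))"
  by (simp add: q_shift_def poly_pcompose mult.commute[of _ q] qint_plus_1[symmetric])

lemma poly_q_bar: "poly (q_bar P) (qint n) = bar_coeff (poly P (qint (- n)))"
proof -
  have "poly (q_bar P) (qint n) = poly (map_poly bar_coeff P) (- q * qint n)"
    by (simp add: q_bar_def poly_pcompose mult.commute)
  then show ?thesis
    unfolding bar_coeff_qint_minus[symmetric] poly_map_bar_coeff .
qed

lemma q_shift_Rq: "P \<in> Rq \<Longrightarrow> q_shift P \<in> Rq"
  by (simp add: Rq_def poly_q_shift)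

lemma q_bar_Rq: "P \<in> Rq \<Longrightarrow> q_bar P \<in> Rq"
  by (simp add: Rq_def poly_q_bar bar_coeff_laurent)

lemma q_shift_add: "q_shift (P + R) = q_shift P + q_shift R"
  by (simp add: q_shift_def pcompose_add)

lemma q_shift_smult: "q_shift (smult c P) = smult c (q_shift P)"
  by (simp add: q_shift_def pcompose_smult)

lemma q_bar_add: "q_bar (P + R) = q_bar P + q_bar R"
proof -
  have "map_poly bar_coeff (P + R) = map_poly bar_coeff P + map_poly bar_coeff R"
    by (rule poly_eqI) (simp add: coeff_map_poly bar_coeff_hom)
  then show ?thesis by (simp add: q_bar_def pcompose_add)
qed

lemma q_bar_smult: "q_bar (smult c P) = smult (bar_coeff c) (q_bar P)"
proof -
  have "map_poly bar_coeff (smult c P) = smult (bar_coeff c) (map_poly bar_coeff P)"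
    by (rule poly_eqI) (simp add: coeff_map_poly bar_coeff_hom)
  then show ?thesis by (simp add: q_bar_def pcompose_smult)
qed

lemma Rq_add: "P \<in> Rq \<Longrightarrow> R \<in> Rq \<Longrightarrow> P + R \<in> Rq"
  by (simp add: Rq_def laurent_add)

lemma Rq_mult: "P \<in> Rq \<Longrightarrow> R \<in> Rq \<Longrightarrow> P * R \<in> Rq"
  by (simp add: Rq_def laurent_mult)

lemma Rq_uminus: "P \<in> Rq \<Longrightarrow> - P \<in> Rq"
  by (simp add: Rq_def laurent_uminus)

lemma Rq_smult: "c \<in> laurent_int \<Longrightarrow> P \<in> Rq \<Longrightarrow> smult c P \<in> Rq"
  by (simp add: Rq_def laurent_mult)

lemma Rq_0: "0 \<in> Rq" and Rq_1: "1 \<in> Rq"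
  by (simp_all add: Rq_def laurent_0 laurent_1)

section \<open>The ideal generated by the cyclotomic polynomial\<close>

lemma cring_Rq: "cring Rq_ring"
proof (rule cringI)
  show "abelian_group Rq_ring"
  proof (rule abelian_groupI)
    fix P assume "P \<in> carrier Rq_ring"
    then show "\<exists>R\<in>carrier Rq_ring. R \<oplus>\<^bsub>Rq_ring\<^esub> P = \<zero>\<^bsub>Rq_ring\<^esub>"
      by (intro bexI[of _ "- P"]) (simp_all add: Rq_ring_def Rq_uminus)
  qed (simp_all add: Rq_ring_def Rq_add Rq_0 add_ac)
  show "comm_monoid Rq_ring"
    by (rule comm_monoidI) (simp_all add: Rq_ring_def Rq_mult Rq_1 mult_ac)
qed (simp add: Rq_ring_def distrib_right)

text \<open>In a commutative ring with unit, the ideal generated by one element is the set of its multiples.\<close>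

lemma Phi_ideal_eq: "Phi_ideal d = smult (ieval q (cyclotomic d)) ` Rq"
proof -
  interpret cring Rq_ring by (rule cring_Rq)
  have "[:ieval q (cyclotomic d):] \<in> Rq"
    by (simp add: Rq_def laurent_ieval laurent_q)
  then show ?thesis
    unfolding Phi_ideal_def to_fract_of_int_poly
    by (subst cgenideal_eq_genideal[symmetric])
      (auto simp: cgenideal_def Rq_ring_def mult.commute[of _ "[:_:]"])
qed

lemma Phi_ideal_add: "A \<in> Phi_ideal d \<Longrightarrow> B \<in> Phi_ideal d \<Longrightarrow> A + B \<in> Phi_ideal d"
  unfolding Phi_ideal_eq by (auto simp: Rq_add simp flip: smult_add_right)

lemma Phi_ideal_0: "0 \<in> Phi_ideal d"
  unfolding Phi_ideal_eq by (rule image_eqI[OF _ Rq_0]) simp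

lemma Phi_ideal_sum: "(\<And>i. i \<in> A \<Longrightarrow> f i \<in> Phi_ideal d) \<Longrightarrow> sum f A \<in> Phi_ideal d"
  by (induction A rule: infinite_finite_induct) (simp_all add: Phi_ideal_0 Phi_ideal_add)

lemma Phi_ideal_smult: "c \<in> laurent_int \<Longrightarrow> A \<in> Phi_ideal d \<Longrightarrow> smult c A \<in> Phi_ideal d"
  unfolding Phi_ideal_eq by (auto simp: Rq_smult mult.commute intro!: image_eqI[of _ _ "smult c _"])

lemma Rq_class_eq: "Rq_class d P = (\<lambda>h. h + P) ` Phi_ideal d"
  by (auto simp: Rq_class_def a_r_coset_def' Rq_ring_def)

lemma Rq_class_eqI:
  assumes "P - R \<in> Phi_ideal d"
  shows "Rq_class d P = Rq_class d R"
proof -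
  have sub: "Rq_class d A \<subseteq> Rq_class d B" if "A - B \<in> Phi_ideal d" for A B
  proof
    fix x assume "x \<in> Rq_class d A"
    then obtain h where h: "h \<in> Phi_ideal d" "x = h + A" unfolding Rq_class_eq by blast
    then have "x = (h + (A - B)) + B" by simp
    then show "x \<in> Rq_class d B"
      unfolding Rq_class_eq using Phi_ideal_add[OF h(1) that] by blast
  qed
  have "R - P \<in> Phi_ideal d" using Phi_ideal_smult[OF laurent_of_int[of "-1"] assms] by simp
  with assms show ?thesis using sub by blast
qed

text \<open>Additivity and stability of the ideal make the class of the image independent of the representative.\<close>

lemma induced_Rq_class:
  assumes add: "\<And>P R. f (P + R) = f P + f R"
    and ideal: "\<And>h. h \<in> Phi_ideal d \<Longrightarrow> f h \<in> Phi_ideal d"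
  shows "induced d f (Rq_class d P) = Rq_class d (f P)"
  unfolding induced_def
proof (rule the_elem_image_unique)
  show "Rq_class d P \<noteq> {}" using Phi_ideal_0 by (auto simp: Rq_class_eq)
  fix R assume "R \<in> Rq_class d P"
  then show "Rq_class d (f R) = Rq_class d (f P)"
    by (auto simp: Rq_class_eq[of d P] add ideal intro!: Rq_class_eqI)
qed

lemma q_shift_Phi_ideal: "h \<in> Phi_ideal d \<Longrightarrow> q_shift h \<in> Phi_ideal d"
  unfolding Phi_ideal_eq by (auto simp: q_shift_smult q_shift_Rq)

text \<open>
  The conjugate of \<open>\<Phi>\<^sub>d(q)\<close> is \<open>\<Phi>\<^sub>d(q\<^sup>-\<^sup>1)\<close>, which is a power of \<open>q\<^sup>-\<^sup>1\<close> times the reversed polynomial at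
  \<open>q\<close>, hence a Laurent multiple of \<open>\<Phi>\<^sub>d(q)\<close>.
\<close>

lemma q_bar_Phi_ideal:
  assumes "d > 0" "h \<in> Phi_ideal d"
  shows "q_bar h \<in> Phi_ideal d"
proof -
  obtain s where s: "reflect_poly (cyclotomic d) = cyclotomic d * s"
    using cyclotomic_dvd_reflect[OF assms(1)] by (elim dvdE)
  define u where "u = inverse q ^ degree (cyclotomic d) * ieval q s"
  have u: "u \<in> laurent_int"
    by (simp add: u_def laurent_mult laurent_power laurent_inverse_q laurent_ieval laurent_q)
  have "q ^ degree (cyclotomic d) * ieval (inverse q) (cyclotomic d)
      = ieval q (cyclotomic d) * ieval q s"
    using ieval_reflect[of q "cyclotomic d"] by (simp add: s ieval_mult)
  then have bar: "bar_coeff (ieval q (cyclotomic d)) = ieval q (cyclotomic d) * u"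
    by (simp add: bar_coeff_ieval u_def field_simps power_inverse)
  obtain P where "P \<in> Rq" "h = smult (ieval q (cyclotomic d)) P"
    using assms(2) unfolding Phi_ideal_eq by blast
  then show ?thesis unfolding Phi_ideal_eq
    by (auto simp: q_bar_smult bar Rq_smult u q_bar_Rq intro!: image_eqI[of _ _ "smult u (q_bar P)"])
qed

section \<open>Values of the basis polynomials\<close>

lemma qint_of_nat: "qint (int n) = (q ^ n - 1) / (q - 1)"
  by (simp add: qint_def)

lemma poly_qbinom_Suc:
  "poly (qbinom_poly (Suc k)) y
    = poly (qbinom_poly k) y * ((y - qint (int k)) / (q ^ k * qint (int (Suc k))))"
  by (simp add: qbinom_poly_def qfact_def numeral_2_eq_2 power_add mult_ac left_diff_distrib)

lemma poly_qbinom_nat: "poly (qbinom_poly k) (qint (int n)) = gauss q n k"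
proof (induction k)
  case (Suc k)
  have D: "q - 1 \<noteq> 0" and Q: "q ^ Suc k - 1 \<noteq> 0" using q_power_neq_1[of "Suc k"] by auto
  have e: "(qint (int n) - qint (int k)) / (q ^ k * qint (int (Suc k)))
      = (q ^ n - q ^ k) / (q ^ k * (q ^ Suc k - 1))"
    unfolding qint_of_nat using D by (simp add: diff_divide_distrib[symmetric] del: power_Suc)
  then show ?case
    unfolding poly_qbinom_Suc Suc.IH e
    using gauss_step[of q n k] Q by (simp add: frac_eq_eq mult_ac del: power_Suc)
qed (simp add: qbinom_poly_def qfact_def numeral_2_eq_2)

text \<open>
  The \<open>q\<close>-analogue of \<open>C(-m - 1, k) = (-1)\<^sup>k C(m + k, k)\<close>: each factor \<open>[-m - 1]\<^sub>q - [i]\<^sub>q\<close> equals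
  \<open>-q\<^bsup>-m - 1\<^esup> [m + 1 + i]\<^sub>q\<close>.
\<close>

lemma poly_qbinom_neg:
  "poly (qbinom_poly k) (qint (- int (Suc m)))
    = (-1) ^ k * inverse q ^ (Suc m * k + (k choose 2)) * gauss q (m + k) k"
proof (induction k)
  case (Suc k)
  have D: "q - 1 \<noteq> 0" and Q: "q ^ Suc k - 1 \<noteq> 0" using q_power_neq_1[of "Suc k"] by auto
  have m: "qint (- int (Suc m)) = (inverse q ^ Suc m - 1) / (q - 1)"
    by (simp add: qint_def power_int_minus power_inverse del: of_nat_Suc power_Suc)
  have "(qint (- int (Suc m)) - qint (int k)) / (q ^ k * qint (int (Suc k)))
      = (inverse q ^ Suc m - q ^ k) / (q ^ k * (q ^ Suc k - 1))"
    unfolding m qint_of_nat using D by (simp add: diff_divide_distrib[symmetric] del: power_Suc)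
  also have "inverse q ^ Suc m - q ^ k = - (inverse q ^ Suc m) * (q ^ Suc (m + k) - 1)"
    by (simp add: algebra_simps power_add power_inverse)
  finally have e: "(qint (- int (Suc m)) - qint (int k)) / (q ^ k * qint (int (Suc k)))
      = - (inverse q ^ Suc m) * (q ^ Suc (m + k) - 1) / (q ^ k * (q ^ Suc k - 1))" .
  have step: "poly (qbinom_poly (Suc k)) (qint (- int (Suc m)))
      = (-1) ^ Suc k * inverse q ^ (Suc m * k + (k choose 2) + Suc m + k)
        * ((q ^ Suc (m + k) - 1) * gauss q (m + k) k / (q ^ Suc k - 1))"
    unfolding poly_qbinom_Suc Suc.IH e power_Suc[of "-1"]
    by (simp add: power_add divide_inverse mult_ac power_inverse
        del: power_Suc mult_Suc mult_Suc_right add_Suc add_Suc_right)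
  have "(q ^ Suc (m + k) - 1) * gauss q (m + k) k / (q ^ Suc k - 1) = gauss q (m + Suc k) (Suc k)"
    unfolding gauss_absorb[symmetric] add_Suc_right using Q by simp
  moreover have "Suc m * k + (k choose 2) + Suc m + k = Suc m * Suc k + (Suc k choose 2)"
    by (simp add: numeral_2_eq_2)
  ultimately show ?case using step by (simp only:)
qed (simp add: qbinom_poly_def qfact_def numeral_2_eq_2)

lemma qbinom_Rq: "qbinom_poly k \<in> Rq"
  unfolding Rq_def
proof (intro CollectI allI)
  fix n :: int
  show "poly (qbinom_poly k) (qint n) \<in> laurent_int"
  proof (cases "n \<ge> 0")
    case True
    then obtain m where "n = int m" by (metis nonneg_int_cases)
    then show ?thesis by (simp add: poly_qbinom_nat laurent_gauss laurent_q)
  next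
    case False
    then obtain m where "n = - int (Suc m)" by (metis negD not_le)
    then show ?thesis
      by (simp only: poly_qbinom_neg)
        (intro laurent_mult laurent_power laurent_uminus laurent_1 laurent_inverse_q laurent_gauss laurent_q)
  qed
qed

text \<open>The points \<open>[n]\<^sub>q\<close> are infinitely many, so they separate polynomials.\<close>

lemma ratfun_poly_eqI:
  assumes "\<And>n::nat. poly P (qint (int n)) = poly R (qint (int n))"
  shows "P = R"
proof (rule ccontr)
  assume "P \<noteq> R"
  then have "finite {y. poly (P - R) y = 0}" by (intro poly_roots_finite) simp
  moreover have "range (\<lambda>n. qint (int n)) \<subseteq> {y. poly (P - R) y = 0}" using assms by auto
  moreover have "inj (\<lambda>n. qint (int n))"
  proof (rule injI)
    have "q ^ m \<noteq> q ^ n" if "m < n" for m n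
    proof -
      have "q ^ n = q ^ m * q ^ (n - m)" using that by (simp flip: power_add)
      then show ?thesis using q_power_neq_1[of "n - m"] that by simp
    qed
    then have "q ^ m = q ^ n \<Longrightarrow> m = n" for m n by (metis linorder_neqE_nat)
    then show "qint (int m) = qint (int n) \<Longrightarrow> m = n" for m n
      by (simp add: qint_of_nat)
  qed
  ultimately show False by (metis finite_subset range_inj_infinite)
qed

section \<open>Reflection of the basis polynomials\<close>

text \<open>
  The case \<open>m = k\<close> of the Vandermonde identity, summed in the opposite order so that the index
  refers to the basis element \<open>j\<close>.
\<close>

lemma gauss_vandermonde_square:
  "gauss z (n + k) k = (\<Sum>j\<le>k. z ^ (j * j) * gauss z k (k - j) * gauss z n j)"
  unfolding add.commute[of n k] gauss_vandermonde
  by (rule sum.reindex_bij_witness[of _ "\<lambda>j. k - j" "\<lambda>j. k - j"]) auto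

text \<open>
  Evaluate at \<open>[n]\<^sub>q\<close>. Conjugating the value at \<open>[-n - 1]\<^sub>q\<close> turns its negative power of \<open>q\<close> into a
  positive one and its base into \<open>q\<^sup>-\<^sup>1\<close>; passing back to base \<open>q\<close> uses up a factor \<open>q\<^bsup>n k\<^esup>\<close>, so the
  remaining exponent \<open>k (k + 1) / 2\<close> no longer depends on \<open>n\<close>. Only then does Vandermonde give an
  expansion with coefficients that are constant in \<open>n\<close>.
\<close>

lemma reflect_qbinom:
  "q_shift (q_bar (qbinom_poly k)) =
    (\<Sum>j\<le>k. smult ((-1) ^ k * q ^ (Suc k choose 2) * q ^ (j * j) * gauss q k (k - j)) (qbinom_poly j))"
proof (rule ratfun_poly_eqI)
  fix n :: nat
  have "poly (q_shift (q_bar (qbinom_poly k))) (qint (int n))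
      = bar_coeff (poly (qbinom_poly k) (qint (- int (Suc n))))"
    by (simp add: poly_q_shift poly_q_bar add.commute)
  also have "\<dots> = (-1) ^ k * q ^ (Suc n * k + (k choose 2)) * gauss (inverse q) (n + k) k"
    unfolding poly_qbinom_neg
    by (simp add: bar_coeff_hom bar_coeff_power bar_coeff_uminus bar_coeff_inverse bar_coeff_gauss)
  also have "Suc n * k + (k choose 2) = (Suc k choose 2) + n * k"
    by (simp add: numeral_2_eq_2)
  also have "(-1) ^ k * q ^ \<dots> * gauss (inverse q) (n + k) k
      = (-1) ^ k * q ^ (Suc k choose 2) * gauss q (n + k) k"
    by (simp add: power_add gauss_inverse[OF q_nonzero q_power_neq_1, symmetric] mult_ac)
  finally show "poly (q_shift (q_bar (qbinom_poly k))) (qint (int n)) = poly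
      (\<Sum>j\<le>k. smult ((-1) ^ k * q ^ (Suc k choose 2) * q ^ (j * j) * gauss q k (k - j)) (qbinom_poly j))
      (qint (int n))"
    by (simp add: gauss_vandermonde_square poly_sum poly_qbinom_nat sum_distrib_left mult_ac)
qed

text \<open>
  The same computation at \<open>q = 1\<close>, with upper negation of binomial coefficients in place of the
  values at \<open>[-n - 1]\<^sub>q\<close>.
\<close>

lemma reflect_binom:
  "shift (bar (binom_poly k)) =
    (\<Sum>j\<le>k. smult ((-1) ^ k * of_nat (k choose j)) (binom_poly j))"
proof -
  let ?R = "\<Sum>j\<le>k. smult ((-1) ^ k * of_nat (k choose j)) (binom_poly j)"
  have val: "poly (shift (bar (binom_poly k))) (of_nat n) = poly ?R (of_nat n)" for n
  proof -
    have "poly (binom_poly k) y = y gchoose k" for y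
      by (simp add: binom_poly_def poly_prod gbinomial_prod_rev atLeast0LessThan)
    then have "poly (shift (bar (binom_poly k))) (of_nat n) = (- 1 - of_nat n) gchoose k"
      by (simp add: shift_def bar_def poly_pcompose)
    also have "- 1 - of_nat n = - (rat_of_nat n + 1)" by simp
    also have "\<dots> gchoose k = (-1) ^ k * of_nat ((n + k) choose k)"
      by (subst gbinomial_minus) (simp add: binomial_gbinomial)
    also have "(n + k) choose k = (\<Sum>j\<le>k. (k choose j) * (n choose j))"
    proof -
      have "rat_of_nat ((n + k) choose k) = of_nat (\<Sum>j\<le>k. (k choose j) * (n choose j))"
        unfolding gauss_one[symmetric] gauss_vandermonde_square
        by (simp add: gauss_one binomial_symmetric[symmetric])
      then show ?thesis by (simp only: of_nat_eq_iff)
    qed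
    finally show ?thesis
      by (simp add: poly_sum poly_binom_poly sum_distrib_left mult.assoc)
  qed
  show ?thesis
  proof (rule ccontr)
    assume "shift (bar (binom_poly k)) \<noteq> ?R"
    then have "finite {y. poly (shift (bar (binom_poly k)) - ?R) y = 0}"
      by (intro poly_roots_finite) simp
    moreover have "range rat_of_nat \<subseteq> {y. poly (shift (bar (binom_poly k)) - ?R) y = 0}"
      using val by auto
    ultimately show False by (metis finite_subset inj_of_nat range_inj_infinite)
  qed
qed

text \<open>
  The polynomial in \<open>X = [:0, 1:]\<close> is the coordinate of \<open>reflect_qbinom\<close> before \<open>X\<close> is set to \<open>q\<close>.
  At a primitive \<open>d\<close>-th root of unity the factor \<open>X\<^bsup>i * i\<^esup>\<close> contributes \<open>1\<close> whenever \<open>d\<close> divides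
  \<open>i\<close>, and for the other \<open>i\<close> the Gaussian factor is zero.
\<close>

lemma cyclotomic_dvd_coeff:
  assumes d: "d > 0" and i: "i \<le> d * k"
  shows "cyclotomic d dvd
    (-1) ^ (d * k) * [:0, 1:] ^ (Suc (d * k) choose 2) * [:0, 1:] ^ (i * i) * gauss [:0, 1:] (d * k) (d * k - i)
      - (if d dvd i then (-1) ^ k * of_nat (k choose (i div d)) else 0)"
    (is "_ dvd ?p - ?r")
proof (rule cyclotomic_dvdI[OF d])
  fix z assume "z \<in> primitive_roots d"
  then have z: "z ^ d = 1" "\<And>k. 0 < k \<Longrightarrow> k < d \<Longrightarrow> z ^ k \<noteq> 1"
    by (auto simp: primitive_roots_def)
  have neg: "ieval z (-1) = -1" using ieval_diff[of z 0 1] by simp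
  have nat: "ieval z (of_nat m) = of_nat m" for m by (induction m) (simp_all add: ieval_add)
  have "ieval z ?p = (-1) ^ k * z ^ (i * i) * gauss z (d * k) (d * k - i)"
    using sign_root_of_unity[OF d z]
    by (simp only: ieval_mult ieval_power ieval_gauss neg) simp
  also have "\<dots> = ieval z ?r"
  proof (cases "d dvd i")
    case True
    then obtain l where l: "i = d * l" by (elim dvdE)
    with i d have "l \<le> k" by simp
    have "z ^ (i * i) = 1" using z(1) by (simp add: l mult.assoc power_mult)
    moreover have "d * k - i = d * (k - l)" by (simp add: l diff_mult_distrib2)
    ultimately show ?thesis using \<open>l \<le> k\<close> d
      by (simp add: gauss_root_of_unity[OF d z] l ieval_mult ieval_power neg nat
          binomial_symmetric[symmetric])
  next
    case False
    then have "\<not> d dvd d * k - i" using i by (metis dvd_diff_nat dvd_triv_left diff_diff_cancel)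
    then show ?thesis using False by (simp add: gauss_root_of_unity[OF d z])
  qed
  finally show "ieval z (?p - ?r) = 0" by (simp add: ieval_diff)
qed

text \<open>
  The case \<open>P = binom_poly k\<close> of the theorem: modulo \<open>\<Phi>\<^sub>d(q)\<close> only the basis elements with index
  divisible by \<open>d\<close> survive, and their coordinates are those of the classical reflection.
\<close>

lemma reflect_qbinom_cong:
  assumes d: "d > 0"
  shows "q_shift (q_bar (qbinom_poly (d * k)))
    - (\<Sum>j\<le>k. smult (of_int ((-1) ^ k * of_nat (k choose j))) (qbinom_poly (d * j))) \<in> Phi_ideal d"
proof -
  let ?X = "[:0, 1:] :: int poly"
  define a where "a i = (-1) ^ (d * k) * ?X ^ (Suc (d * k) choose 2) * ?X ^ (i * i) * gauss ?X (d * k) (d * k - i)" for i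
  define b :: "nat \<Rightarrow> int poly"
    where "b i = (if d dvd i then (-1) ^ k * of_nat (k choose (i div d)) else 0)" for i
  have neg: "ieval q (-1) = -1" using ieval_diff[of q 0 1] by simp
  have nat: "ieval q (of_nat m) = of_nat m" for m by (induction m) (simp_all add: ieval_add)
  have 1: "q_shift (q_bar (qbinom_poly (d * k))) = (\<Sum>i\<le>d * k. smult (ieval q (a i)) (qbinom_poly i))"
    unfolding reflect_qbinom a_def
    by (simp only: ieval_mult ieval_power ieval_gauss neg) simp
  have "(\<Sum>j\<le>k. smult (of_int ((-1) ^ k * of_nat (k choose j))) (qbinom_poly (d * j)))
      = (\<Sum>i\<in>(*) d ` {..k}. smult (ieval q (b i)) (qbinom_poly i))"
    using d by (subst sum.reindex) (auto simp: inj_on_def b_def ieval_mult ieval_power neg nat)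
  also have "\<dots> = (\<Sum>i\<le>d * k. smult (ieval q (b i)) (qbinom_poly i))"
    using d by (intro sum.mono_neutral_left) (auto simp: b_def elim!: dvdE)
  finally have "q_shift (q_bar (qbinom_poly (d * k)))
      - (\<Sum>j\<le>k. smult (of_int ((-1) ^ k * of_nat (k choose j))) (qbinom_poly (d * j)))
      = (\<Sum>i\<le>d * k. smult (ieval q (a i - b i)) (qbinom_poly i))"
    by (simp add: 1 sum_subtractf ieval_diff smult_diff_left)
  also have "\<dots> \<in> Phi_ideal d"
  proof (rule Phi_ideal_sum)
    fix i assume "i \<in> {..d * k}"
    then obtain s where "a i - b i = cyclotomic d * s"
      using cyclotomic_dvd_coeff[OF d, of i k] unfolding a_def b_def by (auto elim: dvdE)
    then have eq: "smult (ieval q (a i - b i)) (qbinom_poly i)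
        = smult (ieval q (cyclotomic d)) (smult (ieval q s) (qbinom_poly i))"
      by (simp add: ieval_mult)
    show "smult (ieval q (a i - b i)) (qbinom_poly i) \<in> Phi_ideal d"
      unfolding eq Phi_ideal_eq by (intro imageI Rq_smult laurent_ieval laurent_q qbinom_Rq)
  qed
  finally show ?thesis .
qed

section \<open>Compatibility of the quantum Frobenius map with the reflections\<close>

text \<open>
  Uniqueness of coordinates lets \<open>Psi d\<close> be computed from any expansion over an initial range of
  indices, also one with zero coefficients.
\<close>

lemma Psi_sum:
  "Psi d (\<Sum>k\<le>N. smult (of_int (c k)) (binom_poly k))
    = Rq_class d (\<Sum>k\<le>N. smult (of_int (c k)) (qbinom_poly (d * k)))"
proof -
  let ?P = "\<Sum>k\<le>N. smult (of_int (c k)) (binom_poly k)"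
  define e where "e k = (if k \<le> N then c k else 0)" for k
  have sum: "(\<Sum>k\<le>N. smult (of_int (c k)) (f k)) = (\<Sum>k | e k \<noteq> 0. smult (of_int (e k)) (f k))"
    for f :: "nat \<Rightarrow> 'a::comm_ring_1 poly"
    by (rule sum.mono_neutral_cong_right) (auto simp: e_def)
  have "finite {k. e k \<noteq> 0}"
    by (rule finite_subset[of _ "{..N}"]) (auto simp: e_def)
  then have e: "is_binom_coords ?P e"
    by (simp add: is_binom_coords_def sum)
  have "?P \<in> Rint"
    unfolding Rint_def by (auto simp: poly_sum poly_binom_poly intro!: Ints_sum Ints_mult)
  then have "binom_coords ?P = e"
    unfolding binom_coords_def using e by (intro the1_equality ex1_binom_coords)
  then show ?thesis by (simp add: Psi_def sum)
qed

lemma smult_sum_right: "smult c (sum f A) = (\<Sum>i\<in>A. smult c (f i))"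
  by (induction A rule: infinite_finite_induct) (simp_all add: smult_add_right)

text \<open>
  Applying a triangular integer matrix \<open>t\<close> to coordinates. The matrix of the reflection is the same for the
  families \<open>binom_poly j\<close> and \<open>qbinom_poly (d * j)\<close>, hence the arbitrary family \<open>b\<close>.
\<close>

lemma sum_triangle_smult:
  fixes b :: "nat \<Rightarrow> 'a::comm_ring_1 poly" and c :: "nat \<Rightarrow> int"
  assumes "\<And>k j. k < j \<Longrightarrow> t k j = 0"
  shows "(\<Sum>k\<le>N. smult (of_int (c k)) (\<Sum>j\<le>k. smult (of_int (t k j)) (b j)))
    = (\<Sum>j\<le>N. smult (of_int (\<Sum>k\<le>N. c k * t k j)) (b j))"
proof -
  have "(\<Sum>j\<le>k. smult (of_int (t k j)) (b j)) = (\<Sum>j\<le>N. smult (of_int (t k j)) (b j))" if "k \<le> N" for k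
    using that assms by (intro sum.mono_neutral_left) auto
  then have "(\<Sum>k\<le>N. smult (of_int (c k)) (\<Sum>j\<le>k. smult (of_int (t k j)) (b j)))
      = (\<Sum>k\<le>N. \<Sum>j\<le>N. smult (of_int (c k * t k j)) (b j))"
    by (simp add: smult_sum_right)
  also have "\<dots> = (\<Sum>j\<le>N. \<Sum>k\<le>N. smult (of_int (c k * t k j)) (b j))"
    by (rule sum.swap)
  finally show ?thesis by (simp add: smult_sum)
qed

theorem proposition7p6:
  fixes d :: nat and P :: "rat poly"
  assumes "d > 0" and "P \<in> Rint"
  shows "Psi d (shift (bar P)) = induced d q_shift (induced d q_bar (Psi d P))"
proof -
  obtain c where c: "is_binom_coords P c" using ex1_binom_coords[OF assms(2)] by blast
  then obtain N where N: "{k. c k \<noteq> 0} \<subseteq> {..N}"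
    by (auto simp: is_binom_coords_def finite_nat_set_iff_bounded_le)
  have P: "P = (\<Sum>k\<le>N. smult (of_int (c k)) (binom_poly k))"
    using c N unfolding is_binom_coords_def by (auto intro: sum.mono_neutral_left)
  define t where "t k j = (-1) ^ k * int (k choose j)" for k j
  define T where "T R = q_shift (q_bar R)" for R
  have t: "t k j = 0" if "k < j" for k j using that by (simp add: t_def)
  have shift_bar_sum: "shift (bar (\<Sum>k\<in>A. smult (x k) (f k))) = (\<Sum>k\<in>A. smult (x k) (shift (bar (f k))))"
    for A :: "nat set" and x f
    by (induction A rule: infinite_finite_induct)
      (simp_all add: shift_def bar_def pcompose_add pcompose_smult)
  have T_sum: "T (\<Sum>k\<in>A. smult (of_int (x k)) (f k)) = (\<Sum>k\<in>A. smult (of_int (x k)) (T (f k)))"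
    for A :: "nat set" and x f
    by (induction A rule: infinite_finite_induct)
      (simp_all add: T_def q_shift_add q_bar_add q_shift_smult q_bar_smult bar_coeff_of_int,
       simp_all add: q_shift_def q_bar_def)
  have "shift (bar P) = (\<Sum>k\<le>N. smult (of_int (c k)) (\<Sum>j\<le>k. smult (of_int (t k j)) (binom_poly j)))"
    unfolding P shift_bar_sum reflect_binom by (simp add: t_def)
  also have "\<dots> = (\<Sum>j\<le>N. smult (of_int (\<Sum>k\<le>N. c k * t k j)) (binom_poly j))"
    by (rule sum_triangle_smult[OF t])
  finally have "Psi d (shift (bar P))
      = Rq_class d (\<Sum>j\<le>N. smult (of_int (\<Sum>k\<le>N. c k * t k j)) (qbinom_poly (d * j)))"
    by (simp only: Psi_sum)
  also have "(\<Sum>j\<le>N. smult (of_int (\<Sum>k\<le>N. c k * t k j)) (qbinom_poly (d * j)))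
      = (\<Sum>k\<le>N. smult (of_int (c k)) (\<Sum>j\<le>k. smult (of_int (t k j)) (qbinom_poly (d * j))))"
    by (rule sum_triangle_smult[OF t, symmetric])
  also have "Rq_class d \<dots> = Rq_class d (T (\<Sum>k\<le>N. smult (of_int (c k)) (qbinom_poly (d * k))))"
  proof (rule Rq_class_eqI[symmetric])
    have "T (qbinom_poly (d * k)) - (\<Sum>j\<le>k. smult (of_int (t k j)) (qbinom_poly (d * j))) \<in> Phi_ideal d"
      for k
      using reflect_qbinom_cong[OF assms(1)] by (simp add: T_def t_def)
    then have "(\<Sum>k\<le>N. smult (of_int (c k)) (T (qbinom_poly (d * k))
        - (\<Sum>j\<le>k. smult (of_int (t k j)) (qbinom_poly (d * j))))) \<in> Phi_ideal d"
      by (intro Phi_ideal_sum Phi_ideal_smult laurent_of_int)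
    then show "T (\<Sum>k\<le>N. smult (of_int (c k)) (qbinom_poly (d * k)))
        - (\<Sum>k\<le>N. smult (of_int (c k)) (\<Sum>j\<le>k. smult (of_int (t k j)) (qbinom_poly (d * j))))
        \<in> Phi_ideal d"
      by (simp add: T_sum smult_diff_right sum_subtractf)
  qed
  also have "\<dots> = induced d q_shift (induced d q_bar (Psi d P))"
    unfolding P Psi_sum T_def
    by (simp add: induced_Rq_class q_bar_add q_shift_add q_shift_Phi_ideal q_bar_Phi_ideal[OF assms(1)])
  finally show ?thesis .
qed

end
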